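(* Let $P$ be a $2$-level polytope. Then $P$ is decomposable if and only if $P$ is, up to affine isomorphism, a Cartesian product of (at least two) proper $2$-level polytopes. Likewise, let $P$ be a compressed polytope. Then $P$ is decomposable if and only if $P$ is, up to affine isomorphism, a Cartesian product of (at least two) proper compressed polytopes.
   Context: Polytopes are nonempty convex polytopes; a polytope is proper if it is not a single point. A polytope $P$ is $2$-level if for every facet-defining hyperplane $H$ of $P$ there is a hyperplane $H'$ parallel to $H$ such that all vertices of $P$ lie in $H\cup H'$. A lattice polytope $P\subset\mathbb{R}^n$ (vertices in $\mathbb{Z}^n$) is compressed if for every facet $F$ and every supporting hyperplane $H$ with $F=P\cap H$, there is at most one hyperplane $H'\neq H$ parallel to $H$ such that $H'\cap P$ contains a lattice point. The Minkowski sum is $Q+R=\{q+r: q\in Q, r\in R\}$. Two polytopes are homothetic if one is obtained from the other by a translation and a dilation with positive factor. A polytope $P$ is decomposable if there are polytopes $Q,R$ with $P=Q+R$ such that neither $Q$ nor $R$ is homothetic to $P$; otherwise $P$ is indecomposable. *)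

theory Defs
  imports "HOL-Analysis.Analysis"
begin

definition hyperplane :: "'a::euclidean_space set \<Rightarrow> bool" where
  "hyperplane H \<longleftrightarrow> (\<exists>a b. a \<noteq> 0 \<and> H = {x. a \<bullet> x = b})"

definition supporting_hyperplane :: "'a::euclidean_space set \<Rightarrow> 'a set \<Rightarrow> bool" where
  "supporting_hyperplane H P \<longleftrightarrow>
     (\<exists>a b. a \<noteq> 0 \<and> H = {x. a \<bullet> x = b} \<and> P \<subseteq> {x. a \<bullet> x \<le> b} \<and> P \<inter> H \<noteq> {})"

(* P need not be full-dimensional, so a facet may be defined by several hyperplanes. *)
definition facet_defining_hyperplane :: "'a::euclidean_space set \<Rightarrow> 'a set \<Rightarrow> bool" where
  "facet_defining_hyperplane H P \<longleftrightarrow> supporting_hyperplane H P \<and> (P \<inter> H) facet_of P"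

definition proper_polytope :: "'a::euclidean_space set \<Rightarrow> bool" where
  "proper_polytope P \<longleftrightarrow> polytope P \<and> P \<noteq> {} \<and> \<not> (\<exists>x. P = {x})"

definition two_level :: "'a::euclidean_space set \<Rightarrow> bool" where
  "two_level P \<longleftrightarrow> polytope P \<and> P \<noteq> {} \<and>
     (\<forall>H. facet_defining_hyperplane H P \<longrightarrow>
        (\<exists>H'. hyperplane H' \<and> affine_parallel H H' \<and> {v. v extreme_point_of P} \<subseteq> H \<union> H'))"

definition lattice_points :: "(real ^ 'n) set" where
  "lattice_points = {x. \<forall>i. x $ i \<in> \<int>}"

definition lattice_polytope :: "(real ^ 'n) set \<Rightarrow> bool" where
  "lattice_polytope P \<longleftrightarrow>
     polytope P \<and> P \<noteq> {} \<and> {v. v extreme_point_of P} \<subseteq> lattice_points"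

definition compressed :: "(real ^ 'n) set \<Rightarrow> bool" where
  "compressed P \<longleftrightarrow> lattice_polytope P \<and>
     (\<forall>F H. F facet_of P \<and> supporting_hyperplane H P \<and> F = P \<inter> H \<longrightarrow>
        (\<exists>\<^sub>\<le>\<^sub>1 H'. hyperplane H' \<and> H' \<noteq> H \<and> affine_parallel H H' \<and>
               H' \<inter> P \<inter> lattice_points \<noteq> {}))"

definition homothetic :: "'a::real_vector set \<Rightarrow> 'a set \<Rightarrow> bool" where
  "homothetic P Q \<longleftrightarrow> (\<exists>c t. c > 0 \<and> Q = (\<lambda>x. c *\<^sub>R x + t) ` P)"

(* The sum Q + R of sets is the Minkowski sum (set_plus_def). *)
definition decomposable :: "'a::euclidean_space set \<Rightarrow> bool" where
  "decomposable P \<longleftrightarrow>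
     (\<exists>Q R. polytope Q \<and> Q \<noteq> {} \<and> polytope R \<and> R \<noteq> {} \<and> P = Q + R \<and>
            \<not> homothetic P Q \<and> \<not> homothetic P R)"

definition affine_map :: "('a::real_vector \<Rightarrow> 'b::real_vector) \<Rightarrow> bool" where
  "affine_map f \<longleftrightarrow> (\<exists>L c. linear L \<and> f = (\<lambda>x. L x + c))"

(* P is affinely isomorphic to a Cartesian product Q 0 x ... x Q (k - 1) of k \<ge> 2 proper
   polytopes in the class C.  The product is the set PiE {..<k} Q of k-tuples; a map into
   a product of spaces is affine iff each of its components f i is, and an affine isomorphism
   of polytopes is an affine map of the ambient spaces that restricts to a bijection.
   The factors share one ambient space 'b, which may differ from that of P; coordinate
   inclusions of R^d into R^m reduce factors in spaces of different dimensions to this. *)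
definition product_of_proper ::
  "('b::euclidean_space set \<Rightarrow> bool) \<Rightarrow> 'a::euclidean_space set \<Rightarrow> bool" where
  "product_of_proper C P \<longleftrightarrow>
     (\<exists>(k::nat) Q f. 2 \<le> k \<and>
        (\<forall>i<k. proper_polytope (Q i) \<and> C (Q i)) \<and>
        (\<forall>i<k. affine_map (f i)) \<and>
        bij_betw (\<lambda>x. \<lambda>i\<in>{..<k}. f i x) P (PiE {..<k} Q))"

end

theory Submission
  imports Defs
begin

text \<open>
A product decomposition always yields a Minkowski decomposition: fixing all coordinates but the first,
respectively only the first, gives two slices through a common point, and their sum is a translate of the
product. Neither slice is homothetic to the whole since some coordinate is constant on it
(\<open>product_imp_decomposable\<close>).

Conversely let \<open>P = Q + R\<close> be \<open>2\<close>-level. Each facet functional \<open>a\<close> of \<open>P\<close> takes only its maximum and its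
minimum at the vertices of \<open>P\<close>. If \<open>v = q + r\<close> is a vertex at which \<open>a\<close> is maximal over \<open>P\<close>, then \<open>a\<close> is
maximal over \<open>Q\<close> at \<open>q\<close>, and likewise for minima. Hence the slacks of \<open>q\<close> are those of \<open>v\<close>, each
multiplied by a ratio of widths depending only on the facet (\<open>summand_slacks\<close>). The facet functionals
separate the points of the affine hull of \<open>P\<close>, so the directions of \<open>P\<close> carry a linear map that is
diagonal in the facet coordinates with these ratios as eigenvalues. If all ratios agree, then \<open>Q\<close> or \<open>R\<close>
is homothetic to \<open>P\<close> (\<open>summand_multiplier\<close>). Otherwise the eigenprojections, which are polynomials in the
map (\<open>multiplier_indicator\<close>), let two nonempty groups of facet coordinates vary independently, and \<open>P\<close> is
a product of two proper polytopes (\<open>split_product\<close>).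

These two factors can be taken to be faces of \<open>P\<close> through a vertex, because at a vertex each facet
functional is extremal. So the factors are \<open>2\<close>-level or compressed as soon as \<open>P\<close> is, since both classes
are closed under nonempty faces (\<open>at_most_two_levels_face\<close>). Compressed polytopes are \<open>2\<close>-level, which
reduces the second equivalence to the same argument.
\<close>

section \<open>Levels of facet functionals and passage to faces\<close>

text \<open>The condition that \<open>2\<close>-level and compressed polytopes share: \<open>V\<close> is the vertex set in the first case
and the set of lattice points of \<open>P\<close> in the second. It is stated through functionals instead of
parallel hyperplanes: off each facet hyperplane, the points of \<open>V\<close> all lie on one further parallel.\<close>

definition at_most_two_levels :: "'a::euclidean_space set \<Rightarrow> 'a set \<Rightarrow> bool" where
  "at_most_two_levels P V \<longleftrightarrow>
     (\<forall>a b. a \<noteq> 0 \<longrightarrow> P \<subseteq> {x. a \<bullet> x \<le> b} \<longrightarrow> (P \<inter> {x. a \<bullet> x = b}) facet_of P \<longrightarrow>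
        (\<forall>x\<in>V. \<forall>y\<in>V. a \<bullet> x \<noteq> b \<longrightarrow> a \<bullet> y \<noteq> b \<longrightarrow> a \<bullet> x = a \<bullet> y))"

lemma mem_translate: "x \<in> (\<lambda>x. t + x) ` S \<longleftrightarrow> x - t \<in> S" for t :: "'a::ab_group_add"
  by (metis add_diff_cancel_left' add_diff_cancel_right' diff_add_cancel add.commute image_iff)

lemma affine_parallel_hyperplane_iff:
  fixes a :: "'a::euclidean_space"
  assumes "a \<noteq> 0"
  shows "affine_parallel {x. a \<bullet> x = b} H \<longleftrightarrow> (\<exists>c. H = {x. a \<bullet> x = c})"
proof
  assume "affine_parallel {x. a \<bullet> x = b} H"
  then obtain t where t: "H = (\<lambda>x. t + x) ` {x. a \<bullet> x = b}"
    by (auto simp: affine_parallel_def)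
  have "H = {x. a \<bullet> x = a \<bullet> t + b}"
  proof (rule set_eqI)
    fix x
    have "x \<in> H \<longleftrightarrow> a \<bullet> (x - t) = b"
      unfolding t mem_translate by simp
    then show "x \<in> H \<longleftrightarrow> x \<in> {x. a \<bullet> x = a \<bullet> t + b}"
      by (auto simp: inner_diff_right)
  qed
  then show "\<exists>c. H = {x. a \<bullet> x = c}" ..
next
  assume "\<exists>c. H = {x. a \<bullet> x = c}"
  then obtain c where c: "H = {x. a \<bullet> x = c}" ..
  define t where "t = ((c - b) / (a \<bullet> a)) *\<^sub>R a"
  have t: "a \<bullet> t = c - b" using assms by (simp add: t_def)
  have "H = (\<lambda>x. t + x) ` {x. a \<bullet> x = b}"
  proof (rule set_eqI)
    fix x
    have "x \<in> (\<lambda>x. t + x) ` {x. a \<bullet> x = b} \<longleftrightarrow> a \<bullet> (x - t) = b"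
      unfolding mem_translate by simp
    then show "x \<in> H \<longleftrightarrow> x \<in> (\<lambda>x. t + x) ` {x. a \<bullet> x = b}"
      by (auto simp: inner_diff_right t c)
  qed
  then show "affine_parallel {x. a \<bullet> x = b} H" by (auto simp: affine_parallel_def)
qed

lemma facet_defining_iff:
  "facet_defining_hyperplane H P \<longleftrightarrow>
     (\<exists>a b. a \<noteq> 0 \<and> H = {x. a \<bullet> x = b} \<and> P \<subseteq> {x. a \<bullet> x \<le> b} \<and> (P \<inter> {x. a \<bullet> x = b}) facet_of P)"
  unfolding facet_defining_hyperplane_def supporting_hyperplane_def facet_of_def by blast

lemma two_level_iff:
  "two_level P \<longleftrightarrow> polytope P \<and> P \<noteq> {} \<and> at_most_two_levels P {v. v extreme_point_of P}"
proof -
  have "(\<exists>H'. hyperplane H' \<and> affine_parallel {x. a \<bullet> x = b} H' \<and>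
            {v. v extreme_point_of P} \<subseteq> {x. a \<bullet> x = b} \<union> H') \<longleftrightarrow>
        (\<forall>x\<in>{v. v extreme_point_of P}. \<forall>y\<in>{v. v extreme_point_of P}.
            a \<bullet> x \<noteq> b \<longrightarrow> a \<bullet> y \<noteq> b \<longrightarrow> a \<bullet> x = a \<bullet> y)" (is "?L \<longleftrightarrow> ?R")
    if "a \<noteq> 0" for a b
  proof
    assume ?L
    then obtain c where "{v. v extreme_point_of P} \<subseteq> {x. a \<bullet> x = b} \<union> {x. a \<bullet> x = c}"
      unfolding affine_parallel_hyperplane_iff[OF \<open>a \<noteq> 0\<close>] by blast
    then have "\<forall>x\<in>{v. v extreme_point_of P}. a \<bullet> x = b \<or> a \<bullet> x = c" by blast
    then show ?R by metis
  next
    assume R: ?R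
    have "\<exists>c. {v. v extreme_point_of P} \<subseteq> {x. a \<bullet> x = b} \<union> {x. a \<bullet> x = c}"
    proof (cases "\<exists>v. v extreme_point_of P \<and> a \<bullet> v \<noteq> b")
      case True
      then obtain v where "v extreme_point_of P" "a \<bullet> v \<noteq> b" by blast
      with R have "{v. v extreme_point_of P} \<subseteq> {x. a \<bullet> x = b} \<union> {x. a \<bullet> x = a \<bullet> v}" by blast
      then show ?thesis ..
    next
      case False
      then show ?thesis by (intro exI[of _ b]) auto
    qed
    then show ?L using that unfolding hyperplane_def affine_parallel_hyperplane_iff[OF that] by blast
  qed
  note levels = this
  have "(\<forall>H. facet_defining_hyperplane H P \<longrightarrow> X H) \<longleftrightarrow>
     (\<forall>a b. a \<noteq> 0 \<longrightarrow> P \<subseteq> {x. a \<bullet> x \<le> b} \<longrightarrow> (P \<inter> {x. a \<bullet> x = b}) facet_of P \<longrightarrow> X {x. a \<bullet> x = b})" for X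
    unfolding facet_defining_iff by blast
  then show ?thesis
    unfolding two_level_def at_most_two_levels_def by (simp add: levels cong: imp_cong)
qed

lemma compressed_iff:
  "compressed P \<longleftrightarrow> lattice_polytope P \<and> at_most_two_levels P (P \<inter> lattice_points)"
proof -
  have "(\<exists>\<^sub>\<le>\<^sub>1 H'. hyperplane H' \<and> H' \<noteq> {x. a \<bullet> x = b} \<and> affine_parallel {x. a \<bullet> x = b} H' \<and>
               H' \<inter> P \<inter> lattice_points \<noteq> {}) \<longleftrightarrow>
        (\<forall>x\<in>P \<inter> lattice_points. \<forall>y\<in>P \<inter> lattice_points.
            a \<bullet> x \<noteq> b \<longrightarrow> a \<bullet> y \<noteq> b \<longrightarrow> a \<bullet> x = a \<bullet> y)" (is "?L \<longleftrightarrow> ?R")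
    if "a \<noteq> 0" for a b
  proof
    assume L: ?L
    show ?R
    proof (intro ballI impI)
      fix x y assume xy: "x \<in> P \<inter> lattice_points" "y \<in> P \<inter> lattice_points" "a \<bullet> x \<noteq> b" "a \<bullet> y \<noteq> b"
      have ok: "hyperplane {z. a \<bullet> z = a \<bullet> w} \<and> {z. a \<bullet> z = a \<bullet> w} \<noteq> {x. a \<bullet> x = b} \<and>
          affine_parallel {x. a \<bullet> x = b} {z. a \<bullet> z = a \<bullet> w} \<and> {z. a \<bullet> z = a \<bullet> w} \<inter> P \<inter> lattice_points \<noteq> {}"
        if "w \<in> P \<inter> lattice_points" "a \<bullet> w \<noteq> b" for w
        using that \<open>a \<noteq> 0\<close> unfolding hyperplane_def affine_parallel_hyperplane_iff[OF \<open>a \<noteq> 0\<close>] by blast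
      have "{z. a \<bullet> z = a \<bullet> x} = {z. a \<bullet> z = a \<bullet> y}"
        using L ok[OF xy(1,3)] ok[OF xy(2,4)] unfolding Uniq_def by blast
      then show "a \<bullet> x = a \<bullet> y" by blast
    qed
  next
    assume R: ?R
    show ?L
    proof (rule Uniq_I, goal_cases)
      case (1 H1 H2)
      then obtain c1 c2 where c: "H1 = {x. a \<bullet> x = c1}" "H2 = {x. a \<bullet> x = c2}"
        unfolding affine_parallel_hyperplane_iff[OF \<open>a \<noteq> 0\<close>] by blast
      with 1 have "c1 \<noteq> b" "c2 \<noteq> b" by auto
      then have "c1 = c2" using 1 c R by blast
      then show ?case using c by simp
    qed
  qed
  note levels = this
  have "(\<forall>a b. a \<noteq> 0 \<longrightarrow> P \<subseteq> {x. a \<bullet> x \<le> b} \<longrightarrow> (P \<inter> {x. a \<bullet> x = b}) facet_of P \<longrightarrow>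
       (\<exists>\<^sub>\<le>\<^sub>1 H'. hyperplane H' \<and> H' \<noteq> {x. a \<bullet> x = b} \<and> affine_parallel {x. a \<bullet> x = b} H' \<and>
               H' \<inter> P \<inter> lattice_points \<noteq> {})) \<longleftrightarrow> at_most_two_levels P (P \<inter> lattice_points)"
    unfolding at_most_two_levels_def by (simp add: levels cong: imp_cong)
  moreover have "(\<forall>F H. F facet_of P \<and> supporting_hyperplane H P \<and> F = P \<inter> H \<longrightarrow> X H) \<longleftrightarrow>
     (\<forall>a b. a \<noteq> 0 \<longrightarrow> P \<subseteq> {x. a \<bullet> x \<le> b} \<longrightarrow> (P \<inter> {x. a \<bullet> x = b}) facet_of P \<longrightarrow> X {x. a \<bullet> x = b})" for X
    proof -
    have "(\<forall>F H. F facet_of P \<and> supporting_hyperplane H P \<and> F = P \<inter> H \<longrightarrow> X H) \<longleftrightarrow>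
        (\<forall>H. facet_defining_hyperplane H P \<longrightarrow> X H)"
      unfolding facet_defining_hyperplane_def by blast
    then show ?thesis unfolding facet_defining_iff by blast
  qed
  ultimately show ?thesis unfolding compressed_def by simp
qed

lemma compressed_imp_two_level:
  assumes "compressed P" shows "two_level P"
proof -
  have "{v. v extreme_point_of P} \<subseteq> P \<inter> lattice_points"
    using assms by (auto simp: compressed_iff lattice_polytope_def extreme_point_of_def)
  then show ?thesis
    using assms unfolding compressed_iff two_level_iff lattice_polytope_def at_most_two_levels_def by blast
qed

text \<open>A facet \<open>G\<close> of a convex set \<open>K\<close> that is not full-dimensional has many defining functionals, but they are
proportional on \<open>K\<close> after subtracting their values on \<open>G\<close>: the affine hull of \<open>K\<close> is spanned by \<open>G\<close>
together with any one point of \<open>K - G\<close>. Hence they have the same level sets in \<open>K\<close>.\<close>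

lemma facet_functional_unique:
  fixes K :: "'a::euclidean_space set"
  assumes K: "convex K" and G: "G facet_of K"
    and a: "G = K \<inter> {z. a \<bullet> z = b}" and a': "G = K \<inter> {z. a' \<bullet> z = b'}"
    and x: "x \<in> K" and y: "y \<in> K" and eq: "a' \<bullet> x = a' \<bullet> y"
  shows "a \<bullet> x = a \<bullet> y"
proof (cases "x \<in> G")
  case True
  then have "a' \<bullet> x = b'" "a \<bullet> x = b" using a a' by blast+
  then have "y \<in> G" using a' y eq by simp
  then have "a \<bullet> y = b" using a by blast
  with \<open>a \<bullet> x = b\<close> show ?thesis by simp
next
  case False
  have Gsub: "G \<subseteq> K" "G \<subseteq> {z. a \<bullet> z = b}" "G \<subseteq> {z. a' \<bullet> z = b'}" using a a' by blast+
  have ne: "a \<bullet> x \<noteq> b" "a' \<bullet> x \<noteq> b'" using False a a' x by blast+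
  have "affine hull G \<subseteq> {z. a \<bullet> z = b}"
    by (rule hull_minimal[where S = affine, OF Gsub(2)]) (rule affine_hyperplane)
  then have "x \<notin> affine hull G" using ne by auto
  then have "aff_dim (insert x G) = aff_dim K"
    using G by (simp add: aff_dim_insert facet_of_def)
  moreover have "insert x G \<subseteq> K" using x Gsub by blast
  then have "affine hull (insert x G) \<subseteq> affine hull K" by (rule hull_mono)
  ultimately have "affine hull (insert x G) = affine hull K"
    by (intro affine_dim_equal) (auto simp: aff_dim_affine_hull)
  then have y': "y \<in> affine hull (insert x G)" using y hull_inc[of y K affine] by simp
  \<comment> \<open>This functional takes one constant value on \<open>G\<close> and at \<open>x\<close>, hence on the affine hull of \<open>K\<close>.\<close>
  define c where "c = (a' \<bullet> x - b') *\<^sub>R a - (a \<bullet> x - b) *\<^sub>R a'"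
  have "affine hull (insert x G) \<subseteq> {z. c \<bullet> z = b * (a' \<bullet> x - b') - b' * (a \<bullet> x - b)}"
  proof (rule hull_minimal)
    have "insert x G \<subseteq> insert x {z. a \<bullet> z = b \<and> a' \<bullet> z = b'}" using Gsub by blast
    then show "insert x G \<subseteq> {z. c \<bullet> z = b * (a' \<bullet> x - b') - b' * (a \<bullet> x - b)}"
      by (auto simp: c_def inner_diff_left algebra_simps)
  qed (rule affine_hyperplane)
  with y' have "c \<bullet> y = b * (a' \<bullet> x - b') - b' * (a \<bullet> x - b)" by auto
  then have "(a' \<bullet> x - b') * (a \<bullet> y - a \<bullet> x) = 0"
    using eq by (simp add: c_def inner_diff_left algebra_simps)
  then show ?thesis using ne by simp
qed

text \<open>A facet of the face \<open>K\<close> is the intersection of \<open>K\<close> with some facet of \<open>P\<close> not containing \<open>K\<close>, so on \<open>K\<close>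
its level sets are those of a facet functional of \<open>P\<close>. Through this, being \<open>2\<close>-level and being
compressed pass to nonempty faces.\<close>

lemma at_most_two_levels_face:
  fixes P :: "'a::euclidean_space set"
  assumes P: "polytope P" and face: "K face_of P" and V: "at_most_two_levels P V" and W: "W \<subseteq> V \<inter> K"
  shows "at_most_two_levels K W"
  unfolding at_most_two_levels_def
proof (intro allI impI ballI)
  fix a b x y
  assume a: "K \<subseteq> {x. a \<bullet> x \<le> b}" and G: "(K \<inter> {x. a \<bullet> x = b}) facet_of K"
    and x: "x \<in> W" "a \<bullet> x \<noteq> b" and y: "y \<in> W" "a \<bullet> y \<noteq> b"
  define G' where "G' = K \<inter> {x. a \<bullet> x = b}"
  have GP: "G' face_of P" "G' \<noteq> {}" "G' \<subseteq> K" "G' \<noteq> K"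
    using G face x W by (auto simp: G'_def facet_of_def intro: face_of_trans)
  then have "G' \<noteq> P" using face face_of_imp_subset by blast
  have "G' = \<Inter>{F. F facet_of P \<and> G' \<subseteq> F}"
    by (rule face_of_polyhedron) (use P GP \<open>G' \<noteq> P\<close> polytope_imp_polyhedron in auto)
  then obtain F where F: "F facet_of P" "G' \<subseteq> F" "\<not> K \<subseteq> F"
    using GP by blast
  obtain a' b' where a': "a' \<noteq> 0" "P \<subseteq> {x. a' \<bullet> x \<le> b'}" "F = P \<inter> {x. a' \<bullet> x = b'}"
    using facet_of_polyhedron[OF polytope_imp_polyhedron[OF P] F(1)] by metis
  have cK: "convex K" using face face_of_imp_convex by blast
  have KP: "K \<subseteq> P" using face face_of_imp_subset by blast
  have "(F \<inter> K) face_of K"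
    using face_of_subset[OF face_of_Int[OF facet_of_imp_face_of[OF F(1)] face] _ KP] by auto
  then have "aff_dim (F \<inter> K) < aff_dim K" using face_of_aff_dim_lt[OF cK] F by blast
  moreover have "aff_dim G' \<le> aff_dim (F \<inter> K)" using F GP by (intro aff_dim_subset) auto
  ultimately have dim: "aff_dim G' = aff_dim (F \<inter> K)" using G by (simp add: facet_of_def G'_def)
  \<comment> \<open>As a face of \<open>F \<inter> K\<close> of full dimension, \<open>G'\<close> is all of it.\<close>
  have GF: "G' = F \<inter> K"
  proof (rule ccontr)
    assume ne: "G' \<noteq> F \<inter> K"
    have "G' face_of (F \<inter> K)"
      by (rule face_of_subset[OF GP(1)]) (use F GP KP in auto)
    moreover have "convex (F \<inter> K)" using \<open>(F \<inter> K) face_of K\<close> face_of_imp_convex by blast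
    ultimately show False using face_of_aff_dim_lt[of "F \<inter> K" G'] ne dim by simp
  qed
  have eqs: "K \<inter> {x. a \<bullet> x = b} = K \<inter> {x. a' \<bullet> x = b'}"
    using GF a' KP by (auto simp: G'_def)
  have "a' \<bullet> x \<noteq> b'" "a' \<bullet> y \<noteq> b'" "x \<in> K" "y \<in> K" "x \<in> V" "y \<in> V" using eqs x y W by auto
  then have "a' \<bullet> x = a' \<bullet> y"
    using V a' F(1) unfolding at_most_two_levels_def by blast
  then show "a \<bullet> x = a \<bullet> y"
    using facet_functional_unique[OF cK G refl eqs \<open>x \<in> K\<close> \<open>y \<in> K\<close>] by simp
qed

lemma two_level_face:
  assumes "two_level P" "K face_of P" "K \<noteq> {}"
  shows "two_level K"
  using assms at_most_two_levels_face[of P K "{v. v extreme_point_of P}" "{v. v extreme_point_of K}"]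
  by (auto simp: two_level_iff extreme_point_of_face intro: face_of_polytope_polytope)

lemma compressed_face:
  assumes "compressed P" "K face_of P" "K \<noteq> {}"
  shows "compressed K"
  using assms at_most_two_levels_face[of P K "P \<inter> lattice_points" "K \<inter> lattice_points"] face_of_imp_subset[of K P]
  by (auto simp: compressed_iff lattice_polytope_def extreme_point_of_face intro: face_of_polytope_polytope)

section \<open>Products are decomposable\<close>

lemma affine_map_combination:
  assumes "affine_map f"
  shows "f (x + y - z) = f x + f y - f z"
  using assms by (auto simp: affine_map_def linear_add linear_diff)

lemma affine_map_homothety_diff:
  assumes "affine_map f"
  shows "f (c *\<^sub>R x + t) - f (c *\<^sub>R y + t) = c *\<^sub>R (f x - f y)"
  using assms by (auto simp: affine_map_def linear_add linear_diff linear_cmul algebra_simps)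

lemma affine_level_set:
  assumes "affine_map f"
  shows "affine {x. f x = c}"
proof -
  obtain L d where L: "linear L" "f = (\<lambda>x. L x + d)" using assms by (auto simp: affine_map_def)
  show ?thesis unfolding affine_def
  proof (intro ballI allI impI)
    fix x y and u v :: real
    assume xy: "x \<in> {x. f x = c}" "y \<in> {x. f x = c}" "u + v = 1"
    have "f (u *\<^sub>R x + v *\<^sub>R y) = u *\<^sub>R f x + v *\<^sub>R f y + (1 - (u + v)) *\<^sub>R d"
      using L by (simp add: linear_add linear_cmul algebra_simps)
    also have "\<dots> = (u + v) *\<^sub>R c" using xy by (simp flip: scaleR_add_left)
    finally show "u *\<^sub>R x + v *\<^sub>R y \<in> {x. f x = c}" using xy by simp
  qed
qed

text \<open>This is how non-homothety of summands is detected: an affine map that collapses \<open>K\<close> to a point also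
collapses every set homothetic to \<open>K\<close>.\<close>

lemma homothetic_nonconstant:
  assumes "homothetic P K" and f: "affine_map f"
    and const: "\<And>x y. x \<in> K \<Longrightarrow> y \<in> K \<Longrightarrow> f x = f y" and "x \<in> P" "y \<in> P"
  shows "f x = f y"
proof -
  obtain c t where c: "c > 0" "K = (\<lambda>x. c *\<^sub>R x + t) ` P"
    using assms by (auto simp: homothetic_def)
  then have "f (c *\<^sub>R x + t) = f (c *\<^sub>R y + t)" using assms by (intro const) auto
  then show ?thesis using affine_map_homothety_diff[OF f, of c x t y] c by simp
qed

lemma affine_map_avg: 
  assumes "affine_map f" shows "f ((1/2) *\<^sub>R x + (1/2) *\<^sub>R y) = (1/2) *\<^sub>R f x + (1/2) *\<^sub>R f y"
proof -
  obtain L d where L: "linear L" "f = (\<lambda>x. L x + d)" using assms by (auto simp: affine_map_def)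
  have "d = (1/2) *\<^sub>R d + (1/2) *\<^sub>R d" by (simp flip: scaleR_add_left)
  then show ?thesis using L by (simp add: linear_add linear_cmul scaleR_add_right)
qed

text \<open>If \<open>P\<close> corresponds to \<open>Q 0 \<times> \<dots> \<times> Q (k - 1)\<close>, then \<open>P\<close> is the sum of its slices \<open>A\<close> (only the coordinate
in \<open>Q 0\<close> moves) and \<open>B\<close> (only the other coordinates move) through a base point \<open>p\<close>, with one of them
translated by \<open>- p\<close>. The coordinate maps \<open>f 1\<close> and \<open>f 0\<close> are not constant on \<open>P\<close>, but \<open>f 1\<close> is constant on
\<open>A\<close> and \<open>f 0\<close> on \<open>B\<close>, so neither slice is homothetic to \<open>P\<close>.\<close>

lemma product_imp_decomposable:
  fixes P :: "'a::euclidean_space set" and C :: "'b::euclidean_space set \<Rightarrow> bool"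
  assumes P: "polytope P" and prod: "product_of_proper C P"
  shows "decomposable P"
proof -
  obtain k :: nat and Q and f :: "nat \<Rightarrow> 'a \<Rightarrow> 'b" where k: "2 \<le> k"
    and Q: "\<And>i. i < k \<Longrightarrow> proper_polytope (Q i)" and f: "\<And>i. i < k \<Longrightarrow> affine_map (f i)"
    and bij: "bij_betw (\<lambda>x. \<lambda>i\<in>{..<k}. f i x) P (PiE {..<k} Q)"
    using prod unfolding product_of_proper_def by blast
  have onto: "\<exists>x\<in>P. \<forall>i<k. f i x = q i" if "\<And>i. i < k \<Longrightarrow> q i \<in> Q i" for q
  proof -
    have "restrict q {..<k} \<in> (\<lambda>x. \<lambda>i\<in>{..<k}. f i x) ` P"
      using bij that unfolding bij_betw_def by auto
    then obtain x where "x \<in> P" and x: "restrict q {..<k} = (\<lambda>i\<in>{..<k}. f i x)" by auto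
    moreover have "f i x = q i" if "i < k" for i using fun_cong[OF x, of i] that by simp
    ultimately show ?thesis by blast
  qed
  have fQ: "f i x \<in> Q i" if "x \<in> P" "i < k" for x i
  proof -
    have "(\<lambda>i\<in>{..<k}. f i x) \<in> PiE {..<k} Q" by (rule bij_betw_apply[OF bij that(1)])
    from PiE_mem[OF this, of i] show ?thesis using that(2) by simp
  qed
  have inj: "x = y" if "x \<in> P" "y \<in> P" "\<And>i. i < k \<Longrightarrow> f i x = f i y" for x y
  proof -
    have "(\<lambda>i\<in>{..<k}. f i x) = (\<lambda>i\<in>{..<k}. f i y)" using that(3) by (auto simp: restrict_def)
    then show ?thesis using bij that(1,2) unfolding bij_betw_def inj_on_def by blast
  qed
  have cvx: "convex P" using P polytope_imp_convex by blast
  \<comment> \<open>Injectivity is only available on \<open>P\<close>, and midpoints stay there.\<close>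
  have parallelogram: "x + y = z + w"
    if "x \<in> P" "y \<in> P" "z \<in> P" "w \<in> P" "\<And>i. i < k \<Longrightarrow> f i x + f i y = f i z + f i w" for x y z w
  proof -
    have "(1/2) *\<^sub>R x + (1/2) *\<^sub>R y = (1/2) *\<^sub>R z + (1/2) *\<^sub>R w"
    proof (rule inj)
      fix i assume "i < k"
      then show "f i ((1/2) *\<^sub>R x + (1/2) *\<^sub>R y) = f i ((1/2) *\<^sub>R z + (1/2) *\<^sub>R w)"
        unfolding affine_map_avg[OF f[OF \<open>i < k\<close>]] using that(5)[of i]
        by (simp flip: scaleR_add_right)
    qed (use that cvx in \<open>auto intro!: convexD\<close>)
    then show ?thesis by (simp flip: scaleR_add_right)
  qed
  have Qne: "\<exists>x\<in>Q i. \<exists>y\<in>Q i. x \<noteq> y" if "i < k" for i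
    using Q[OF that] unfolding proper_polytope_def by blast
  then have "\<forall>i. \<exists>y. i < k \<longrightarrow> y \<in> Q i" by blast
  then obtain q where q: "\<And>i. i < k \<Longrightarrow> q i \<in> Q i" by metis
  obtain p where p: "p \<in> P" "\<And>i. i < k \<Longrightarrow> f i p = q i" using onto[OF q] by blast
  have nonconst: "\<exists>x\<in>P. \<exists>y\<in>P. f i x \<noteq> f i y" if "i < k" for i
  proof -
    obtain x y where xy: "x \<in> Q i" "y \<in> Q i" "x \<noteq> y" using Qne[OF \<open>i < k\<close>] by blast
    obtain x' where "x' \<in> P" "f i x' = x" using onto[of "q(i := x)"] q xy \<open>i < k\<close> by fastforce
    moreover obtain y' where "y' \<in> P" "f i y' = y" using onto[of "q(i := y)"] q xy \<open>i < k\<close> by fastforce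
    ultimately show ?thesis using xy by blast
  qed
  define A where "A = P \<inter> (\<Inter>i\<in>{1..<k}. {x. f i x = f i p})"
  define B where "B = P \<inter> {x. f 0 x = f 0 p}"
  have polyA: "polytope A" "p \<in> A" "A \<subseteq> P" and polyB: "polytope B" "p \<in> B" "B \<subseteq> P"
    unfolding A_def B_def using P p f k
    by (auto intro!: polytope_Int_polyhedron affine_imp_polyhedron affine_Inter affine_level_set)
  have sum: "P = A + (\<lambda>x. x - p) ` B"
  proof (intro subset_antisym subsetI)
    fix x assume x: "x \<in> P"
    obtain a where a: "a \<in> P" "\<And>i. i < k \<Longrightarrow> f i a = (if i = 0 then f 0 x else f i p)"
      using onto[of "\<lambda>i. if i = 0 then f 0 x else f i p"] fQ x p by (metis (no_types, lifting))
    obtain b where b: "b \<in> P" "\<And>i. i < k \<Longrightarrow> f i b = (if i = 0 then f 0 p else f i x)"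
      using onto[of "\<lambda>i. if i = 0 then f 0 p else f i x"] fQ x p by (metis (no_types, lifting))
    have "a + b = x + p" by (rule parallelogram) (use a b x p in auto)
    then have "x = a + (b - p)" by (simp add: algebra_simps)
    moreover have "a \<in> A" "b \<in> B" using a b k by (auto simp: A_def B_def)
    ultimately show "x \<in> A + (\<lambda>x. x - p) ` B" by (auto simp: set_plus_def)
  next
    fix x assume "x \<in> A + (\<lambda>x. x - p) ` B"
    then obtain a b where ab: "a \<in> A" "b \<in> B" "x = a + (b - p)" by (auto simp: set_plus_def)
    then have abP: "a \<in> P" "b \<in> P" using polyA polyB by auto
    obtain y where y: "y \<in> P" "\<And>i. i < k \<Longrightarrow> f i y = (if i = 0 then f 0 a else f i b)"
      using onto[of "\<lambda>i. if i = 0 then f 0 a else f i b"] fQ abP by (metis (no_types, lifting))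
    have "a + b = y + p" by (rule parallelogram) (use ab abP y p in \<open>auto simp: A_def B_def\<close>)
    then have "x = y" using ab by (simp add: algebra_simps)
    then show "x \<in> P" using y by simp
  qed
  have "\<not> homothetic P A"
  proof
    assume "homothetic P A"
    then have "f 1 x = f 1 y" if "x \<in> P" "y \<in> P" for x y
      by (rule homothetic_nonconstant) (use f k that in \<open>auto simp: A_def\<close>)
    moreover have "1 < k" using k by simp
    ultimately show False using nonconst by blast
  qed
  moreover have "\<not> homothetic P ((\<lambda>x. x - p) ` B)"
  proof
    assume hom: "homothetic P ((\<lambda>x. x - p) ` B)"
    have "f 0 x = f 0 y" if "x \<in> P" "y \<in> P" for x y
    proof (rule homothetic_nonconstant[OF hom _ _ that])
      fix x y assume "x \<in> (\<lambda>x. x - p) ` B" "y \<in> (\<lambda>x. x - p) ` B"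
      then obtain x' y' where "x = x' - p" "y = y' - p" "f 0 x' = f 0 y'" by (auto simp: B_def)
      then show "f 0 x = f 0 y"
        using affine_map_combination[OF f, of 0 x' 0 p] affine_map_combination[OF f, of 0 y' 0 p] k
        by simp
    qed (use f k in auto)
    moreover have "0 < k" using k by simp
    ultimately show False using nonconst by blast
  qed
  moreover have "polytope ((\<lambda>x. x - p) ` B)"
    using polyB(1) polytope_translation_eq[of "- p" B] by simp
  ultimately show ?thesis
    unfolding decomposable_def using sum polyA polyB by blast
qed

section \<open>Decomposable two-level polytopes are products\<close>

text \<open>A polytope given by inequalities \<open>a h \<bullet> x \<le> b h\<close> within its affine hull, each with only two levels at
the vertices, as the facets of a \<open>2\<close>-level polytope provide; \<open>c h\<close> is the second level, which is attained as the minimum of \<open>a h\<close>. The vertex \<open>p\<close> serves as origin of the affine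
hull.\<close>

locale two_level_inequalities =
  fixes P :: "'a::euclidean_space set" and F :: "'i set" and a :: "'i \<Rightarrow> 'a"
    and b c :: "'i \<Rightarrow> real" and p :: 'a
  assumes polytope_P: "polytope P" and finite_F: "finite F"
    and sufficient: "\<And>x. x \<in> affine hull P \<Longrightarrow> (\<And>h. h \<in> F \<Longrightarrow> a h \<bullet> x \<le> b h) \<Longrightarrow> x \<in> P"
    and upper: "\<And>h x. h \<in> F \<Longrightarrow> x \<in> P \<Longrightarrow> a h \<bullet> x \<le> b h"
    and gap: "\<And>h. h \<in> F \<Longrightarrow> c h < b h"
    and levels: "\<And>h v. h \<in> F \<Longrightarrow> v extreme_point_of P \<Longrightarrow> a h \<bullet> v = b h \<or> a h \<bullet> v = c h"
    and nonconstant: "\<And>h. h \<in> F \<Longrightarrow> \<exists>x\<in>P. \<exists>y\<in>P. a h \<bullet> x \<noteq> a h \<bullet> y"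
    and vertex: "p extreme_point_of P"
begin

abbreviation "vertices \<equiv> {v. v extreme_point_of P}"

definition directions :: "'a set" where
  "directions = span ((\<lambda>v. v - p) ` vertices)"

text \<open>\<open>g\<close> is a multiplier if scaling the coordinates \<open>a h \<bullet> d\<close> by \<open>g h\<close> maps the direction space into itself.
In the coordinates given by the facet functionals such a map is diagonal, so the multipliers form an
algebra under pointwise operations.\<close>

definition multiplier :: "('i \<Rightarrow> real) \<Rightarrow> bool" where
  "multiplier g \<longleftrightarrow> (\<forall>d\<in>directions. \<exists>e\<in>directions. \<forall>h\<in>F. a h \<bullet> e = g h * (a h \<bullet> d))"

lemma hull_vertices: "P = convex hull vertices"
  by (rule Krein_Milman_Minkowski[OF polytope_imp_compact[OF polytope_P] polytope_imp_convex[OF polytope_P]])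

lemma p_in: "p \<in> P"
  using vertex by (simp add: extreme_point_of_def)

lemma lower:
  assumes "h \<in> F" "x \<in> P" shows "c h \<le> a h \<bullet> x"
proof -
  have "vertices \<subseteq> {x. a h \<bullet> x \<ge> c h}"
    using levels[OF \<open>h \<in> F\<close>] gap[OF \<open>h \<in> F\<close>] by force
  then have "convex hull vertices \<subseteq> {x. a h \<bullet> x \<ge> c h}"
    by (rule hull_minimal) (rule convex_halfspace_ge)
  then show ?thesis using assms hull_vertices by auto
qed

lemma affine_hull_eq: "affine hull P = (\<lambda>d. p + d) ` directions"
proof -
  have "affine hull P = affine hull vertices"
    using hull_vertices affine_hull_convex_hull by metis
  also have "\<dots> = (\<lambda>d. p + d) ` directions"
    unfolding directions_def
    using affine_hull_span_gen[of p vertices] vertex by (simp add: hull_inc)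
  finally show ?thesis .
qed

lemma subspace_directions: "subspace directions"
  by (simp add: directions_def)

lemma diff_in_directions:
  assumes "x \<in> affine hull P" "y \<in> affine hull P" shows "x - y \<in> directions"
proof -
  obtain d e where "d \<in> directions" "e \<in> directions" "x = p + d" "y = p + e"
    using assms unfolding affine_hull_eq by blast
  then show ?thesis using subspace_diff[OF subspace_directions] by simp
qed

lemma add_direction:
  assumes "x \<in> affine hull P" "d \<in> directions" shows "x + d \<in> affine hull P"
proof -
  obtain e where "e \<in> directions" "x = p + e"
    using assms unfolding affine_hull_eq by blast
  then show ?thesis
    unfolding affine_hull_eq using subspace_add[OF subspace_directions _ assms(2)] by (simp add: add.assoc)
qed

lemma in_hull: "x \<in> P \<Longrightarrow> x \<in> affine hull P"
  by (simp add: hull_inc)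

text \<open>A direction killed by all facet functionals would span a line inside the bounded set \<open>P\<close>.\<close>

lemma separation:
  assumes d: "d \<in> directions" and zero: "\<And>h. h \<in> F \<Longrightarrow> a h \<bullet> d = 0"
  shows "d = 0"
proof (rule ccontr)
  assume "d \<noteq> 0"
  have line: "p + t *\<^sub>R d \<in> P" for t
  proof (rule sufficient)
    show "p + t *\<^sub>R d \<in> affine hull P"
      by (rule add_direction[OF in_hull[OF p_in] subspace_scale[OF subspace_directions d]])
  qed (simp add: inner_add_right zero upper p_in)
  obtain B where B: "\<And>x. x \<in> P \<Longrightarrow> norm x \<le> B"
    using polytope_imp_bounded[OF polytope_P] by (auto simp: bounded_iff)
  \<comment> \<open>The point at parameter \<open>t\<close> on this line is too far out to have norm at most \<open>B\<close>.\<close>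
  define t where "t = (B + norm p + 1) / norm d"
  have "B \<ge> 0" using B[OF p_in] norm_ge_zero order_trans by blast
  then have "norm (t *\<^sub>R d) = B + norm p + 1" using \<open>d \<noteq> 0\<close> by (simp add: t_def)
  moreover have "norm (t *\<^sub>R d) \<le> norm (p + t *\<^sub>R d) + norm p"
    using norm_triangle_ineq4[of "p + t *\<^sub>R d" p] by simp
  ultimately show False using B[OF line[of t]] by linarith
qed

lemma separation_points:
  assumes "x \<in> affine hull P" "y \<in> affine hull P" "\<And>h. h \<in> F \<Longrightarrow> a h \<bullet> x = a h \<bullet> y"
  shows "x = y"
  using separation[OF diff_in_directions[OF assms(1,2)]] assms(3) by (simp add: inner_diff_right)

lemma multiplier_cong:
  assumes "multiplier g" "\<And>h. h \<in> F \<Longrightarrow> g h = g' h" shows "multiplier g'"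
  using assms by (simp add: multiplier_def)

lemma multiplier_affine:
  assumes "multiplier g" shows "multiplier (\<lambda>h. s * g h + t)"
  unfolding multiplier_def
proof
  fix d assume d: "d \<in> directions"
  then obtain e where e: "e \<in> directions" "\<And>h. h \<in> F \<Longrightarrow> a h \<bullet> e = g h * (a h \<bullet> d)"
    using assms by (auto simp: multiplier_def)
  have "s *\<^sub>R e + t *\<^sub>R d \<in> directions"
    using d e subspace_directions by (simp add: subspace_add subspace_scale)
  then show "\<exists>e\<in>directions. \<forall>h\<in>F. a h \<bullet> e = (s * g h + t) * (a h \<bullet> d)"
    by (rule bexI[rotated]) (auto simp: e inner_add_right algebra_simps)
qed

lemma multiplier_mult:
  assumes "multiplier g" "multiplier g'" shows "multiplier (\<lambda>h. g h * g' h)"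
  unfolding multiplier_def
proof
  fix d assume "d \<in> directions"
  then obtain e where e: "e \<in> directions" "\<And>h. h \<in> F \<Longrightarrow> a h \<bullet> e = g' h * (a h \<bullet> d)"
    using assms(2) by (auto simp: multiplier_def)
  then obtain e' where "e' \<in> directions" "\<And>h. h \<in> F \<Longrightarrow> a h \<bullet> e' = g h * (a h \<bullet> e)"
    using assms(1) by (auto simp: multiplier_def)
  then show "\<exists>e\<in>directions. \<forall>h\<in>F. a h \<bullet> e = g h * g' h * (a h \<bullet> d)"
    using e by (intro bexI[of _ e']) (simp_all add: mult.assoc)
qed

text \<open>The projection onto an eigenspace of a diagonal map is a polynomial in the map, here the Lagrange
interpolation polynomial that is \<open>1\<close> at \<open>l0\<close> and \<open>0\<close> at the other eigenvalues.\<close>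

lemma multiplier_indicator:
  assumes "multiplier l"
  shows "multiplier (\<lambda>h. if l h = l0 then 1 else 0)"
proof -
  have "multiplier (\<lambda>h. \<Prod>\<mu>\<in>M. (l h - \<mu>) / (l0 - \<mu>))" if "finite M" for M
    using that
  proof induction
    case empty
    have "multiplier (\<lambda>h. 0 * l h + 1)" by (rule multiplier_affine[OF assms])
    then show ?case by simp
  next
    case (insert \<mu> M)
    have "multiplier (\<lambda>h. (1 / (l0 - \<mu>)) * l h + (- \<mu> / (l0 - \<mu>)))"
      by (rule multiplier_affine[OF assms])
    then have "multiplier (\<lambda>h. (l h - \<mu>) / (l0 - \<mu>))" by (simp add: diff_divide_distrib)
    from multiplier_mult[OF this insert.IH] show ?case
      by (simp only: prod.insert[OF insert.hyps])
  qed
  then have "multiplier (\<lambda>h. \<Prod>\<mu>\<in>l ` F - {l0}. (l h - \<mu>) / (l0 - \<mu>))"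
    using finite_F by simp
  moreover have "(\<Prod>\<mu>\<in>l ` F - {l0}. (l h - \<mu>) / (l0 - \<mu>)) = (if l h = l0 then 1 else 0)"
    if "h \<in> F" for h
  proof (cases "l h = l0")
    case True
    then show ?thesis by (auto intro!: prod.neutral)
  next
    case False
    then show ?thesis using that finite_F by (auto intro!: prod_zero)
  qed
  ultimately show ?thesis by (rule multiplier_cong)
qed

text \<open>Choosing images on a basis gives a linear map of the ambient space, from which the affine coordinate
maps of the product are made.\<close>

lemma multiplier_linear:
  assumes "multiplier g"
  obtains T where "linear T" "\<And>d. d \<in> directions \<Longrightarrow> T d \<in> directions"
    "\<And>d h. d \<in> directions \<Longrightarrow> h \<in> F \<Longrightarrow> a h \<bullet> T d = g h * (a h \<bullet> d)"
proof -
  obtain e where e: "\<And>d. d \<in> directions \<Longrightarrow> e d \<in> directions"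
     "\<And>d h. d \<in> directions \<Longrightarrow> h \<in> F \<Longrightarrow> a h \<bullet> e d = g h * (a h \<bullet> d)"
    using assms unfolding multiplier_def by metis
  obtain B where B: "B \<subseteq> directions" "independent B" "directions = span B"
    using basis_exists[of directions] subspace_directions
    by (metis span_eq_iff span_mono subset_antisym)
  obtain T where T: "linear T" "\<And>d. d \<in> B \<Longrightarrow> T d = e d"
    using linear_independent_extend[OF B(2), of e] by blast
  have "T d \<in> directions \<and> (\<forall>h\<in>F. a h \<bullet> T d = g h * (a h \<bullet> d))" if "d \<in> span B" for d
    using that
  proof (induction rule: span_induct_alt)
    case base
    then show ?case using T by (simp add: linear_0 subspace_0[OF subspace_directions])
  next
    case (step s x y)
    then show ?case
      using T e B subspace_directions
      by (auto simp: linear_add linear_cmul subspace_add subspace_scale inner_add_right algebra_simps)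
  qed
  then show ?thesis using that T B by blast
qed

text \<open>At a vertex every facet functional is at its maximum or its minimum over \<open>P\<close>, so each equation
\<open>a h \<bullet> x = a h \<bullet> p\<close> cuts out a face.\<close>

lemma fixed_levels_face:
  assumes "J \<subseteq> F" shows "{x \<in> P. \<forall>h\<in>J. a h \<bullet> x = a h \<bullet> p} face_of P"
proof -
  have cvx: "convex P" using polytope_P polytope_imp_convex by blast
  have face: "(P \<inter> {x. a h \<bullet> x = a h \<bullet> p}) face_of P" if "h \<in> J" for h
  proof -
    have "h \<in> F" using that assms by auto
    from levels[OF this vertex] show ?thesis
    proof
      assume "a h \<bullet> p = b h"
      then show ?thesis using face_of_Int_supporting_hyperplane_le[OF cvx, of "a h" "b h"] upper[OF \<open>h \<in> F\<close>] by simp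
    next
      assume "a h \<bullet> p = c h"
      then show ?thesis using face_of_Int_supporting_hyperplane_ge[OF cvx, of "c h" "a h"] lower[OF \<open>h \<in> F\<close>] by simp
    qed
  qed
  show ?thesis
  proof (cases "J = {}")
    case True
    then show ?thesis using face_of_refl[OF cvx] by simp
  next
    case False
    have "{x \<in> P. \<forall>h\<in>J. a h \<bullet> x = a h \<bullet> p} = \<Inter>((\<lambda>h. P \<inter> {x. a h \<bullet> x = a h \<bullet> p}) ` J)"
      using False by auto
    then show ?thesis using face_of_Inter[of "(\<lambda>h. P \<inter> {x. a h \<bullet> x = a h \<bullet> p}) ` J" P] False face by auto
  qed
qed

text \<open>If the coordinates \<open>a h \<bullet> x\<close> for \<open>h \<in> I\<close> and for \<open>h \<in> F - I\<close> can be prescribed independently, then \<open>P\<close> is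
the product of the faces \<open>K 0\<close> and \<open>K 1\<close> through \<open>p\<close>, in which only one of the two groups varies: each
inequality involves the coordinates of only one group. The factors belong to \<open>C\<close> because they are faces.\<close>

lemma split_product:
  assumes I: "I \<subseteq> F" "I \<noteq> {}" "I \<noteq> F" and ind: "multiplier (\<lambda>h. if h \<in> I then 1 else 0)"
    and C: "\<And>K. K face_of P \<Longrightarrow> K \<noteq> {} \<Longrightarrow> C K"
  shows "product_of_proper C P"
proof -
  obtain T where T: "linear T" "\<And>d. d \<in> directions \<Longrightarrow> T d \<in> directions"
    "\<And>d h. d \<in> directions \<Longrightarrow> h \<in> F \<Longrightarrow> a h \<bullet> T d = (if h \<in> I then 1 else 0) * (a h \<bullet> d)"
    using multiplier_linear[OF ind] by blast
  \<comment> \<open>\<open>T\<close> keeps the coordinates in \<open>I\<close> and kills the others, so \<open>f 0\<close> resets the latter to those of \<open>p\<close> and \<open>f 1\<close> the former.\<close>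
  define K where "K i = {x \<in> P. \<forall>h\<in>(if i = 0 then F - I else I). a h \<bullet> x = a h \<bullet> p}" for i :: nat
  define f where "f i = (\<lambda>x. if i = 0 then p + T (x - p) else x - T (x - p))" for i :: nat
  have dir: "x - p \<in> directions" if "x \<in> P" for x
    using that p_in in_hull diff_in_directions by blast
  have f_val: "a h \<bullet> f i x = (if (h \<in> I) = (i = 0) then a h \<bullet> x else a h \<bullet> p)"
    if "x \<in> P" "h \<in> F" for h i x
    using T(3)[OF dir[OF that(1)] that(2)] by (simp add: f_def inner_add_right inner_diff_right)
  have f_hull: "f i x \<in> affine hull P" if "x \<in> P" for i x
    using add_direction[OF in_hull[OF p_in] T(2)[OF dir[OF that]]]
      add_direction[OF in_hull[OF that] subspace_neg[OF subspace_directions T(2)[OF dir[OF that]]]]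
    by (simp add: f_def)
  have f_in: "f i x \<in> K i" if "x \<in> P" for i x
    unfolding K_def using that p_in upper I
    by (auto simp: f_val intro!: sufficient f_hull)
  have f_affine: "affine_map (f i)" for i
  proof -
    have "f i = (\<lambda>x. (if i = 0 then T x else x - T x) + (if i = 0 then p - T p else T p))"
      by (auto simp: f_def linear_diff[OF T(1)])
    moreover have "linear (\<lambda>x. if i = 0 then T x else x - T x)"
      using T(1) linear_compose_sub[OF linear_id T(1)] by (cases "i = 0") (simp_all add: id_def)
    ultimately show ?thesis unfolding affine_map_def by blast
  qed
  have face: "K i face_of P" for i
    unfolding K_def using I by (intro fixed_levels_face) auto
  have pK: "p \<in> K i" for i using p_in by (simp add: K_def)
  have proper: "proper_polytope (K i)" for i
  proof -
    obtain h where h: "h \<in> F" "(h \<in> I) = (i = 0)" using I by (cases "i = 0") auto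
    obtain x where x: "x \<in> P" "a h \<bullet> x \<noteq> a h \<bullet> p" using nonconstant[OF h(1)] by metis
    then have "a h \<bullet> f i x \<noteq> a h \<bullet> p" using h by (simp add: f_val)
    then have "f i x \<noteq> p" by auto
    then have "\<nexists>y. K i = {y}" using f_in[OF x(1), of i] pK[of i] by auto
    then show ?thesis
      unfolding proper_polytope_def using face_of_polytope_polytope[OF polytope_P face] pK by blast
  qed
  have inverse: "f 0 x + f 1 x - p = x" for x by (simp add: f_def)
  have glue: "\<exists>x\<in>P. f 0 x = y \<and> f 1 x = z" if y: "y \<in> K 0" and z: "z \<in> K 1" for y z
  proof -
    define x where "x = y + (z - p)"
    have yz: "y \<in> P" "z \<in> P" using y z by (auto simp: K_def)
    have val: "a h \<bullet> x = (if h \<in> I then a h \<bullet> y else a h \<bullet> z)" if "h \<in> F" for h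
      using y z that by (auto simp: x_def K_def inner_add_right inner_diff_right)
    have "x \<in> P"
    proof (rule sufficient)
      show "x \<in> affine hull P"
        unfolding x_def by (rule add_direction[OF in_hull[OF yz(1)] dir[OF yz(2)]])
    qed (simp add: val upper yz)
    have "f 0 x = y"
      by (rule separation_points[OF f_hull[OF \<open>x \<in> P\<close>] in_hull[OF yz(1)]])
        (use y in \<open>simp add: f_val[OF \<open>x \<in> P\<close>] val K_def\<close>)
    moreover have "f 1 x = z"
      by (rule separation_points[OF f_hull[OF \<open>x \<in> P\<close>] in_hull[OF yz(2)]])
        (use z in \<open>simp add: f_val[OF \<open>x \<in> P\<close>] val K_def\<close>)
    ultimately show ?thesis using \<open>x \<in> P\<close> by blast
  qed
  have "bij_betw (\<lambda>x. \<lambda>i\<in>{..<2}. f i x) P (PiE {..<2} K)"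
    unfolding bij_betw_def
  proof
    show "inj_on (\<lambda>x. \<lambda>i\<in>{..<2}. f i x) P"
    proof (rule inj_onI)
      fix x y assume eq: "(\<lambda>i\<in>{..<2}. f i x) = (\<lambda>i\<in>{..<2}. f i y)"
      have "f 0 x = f 0 y" "f 1 x = f 1 y" using fun_cong[OF eq, of 0] fun_cong[OF eq, of 1] by simp_all
      then show "x = y" using inverse[of x] inverse[of y] by metis
    qed
    show "(\<lambda>x. \<lambda>i\<in>{..<2}. f i x) ` P = PiE {..<2} K"
    proof (intro subset_antisym subsetI)
      fix u assume u: "u \<in> PiE {..<2} K"
      have "u 0 \<in> K 0" "u 1 \<in> K 1" using PiE_mem[OF u, of 0] PiE_mem[OF u, of 1] by simp_all
      then obtain x where x: "x \<in> P" "f 0 x = u 0" "f 1 x = u 1" using glue by blast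
      have "u = (\<lambda>i\<in>{..<2}. f i x)"
      proof
        fix i :: nat
        consider "i = 0" | "i = 1" | "\<not> i < 2" by linarith
        then show "u i = (\<lambda>i\<in>{..<2}. f i x) i"
          using x u PiE_arb[OF u, of i] by cases simp_all
      qed
      then show "u \<in> (\<lambda>x. \<lambda>i\<in>{..<2}. f i x) ` P" using x by blast
    qed (use f_in in \<open>force intro: PiE_I\<close>)
  qed
  moreover have "\<forall>i<2. proper_polytope (K i) \<and> C (K i)" using proper C[OF face] pK by blast
  ultimately show ?thesis
    unfolding product_of_proper_def using f_affine by (intro exI[of _ "2::nat"] exI[of _ K] exI[of _ f]) simp
qed

text \<open>The maximum of \<open>a h\<close> over \<open>P\<close> is the sum of its maxima over \<open>Q\<close> and \<open>R\<close>, and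
likewise for minima. So if a vertex \<open>v = q + r\<close> is at the maximum over \<open>P\<close>, then \<open>q\<close> is at the maximum
over \<open>Q\<close>, and similarly for minima. As \<open>v\<close> is always at one of the two, the slack of \<open>q\<close> is the slack of
\<open>v\<close> times the ratio \<open>l h\<close> of the widths of \<open>Q\<close> and \<open>P\<close>.\<close>

lemma summand_slacks:
  assumes Q: "polytope Q" "Q \<noteq> {}" and sum: "P = Q + R"
  obtains l m where
    "\<And>h v q r. h \<in> F \<Longrightarrow> v extreme_point_of P \<Longrightarrow> q \<in> Q \<Longrightarrow> r \<in> R \<Longrightarrow> v = q + r \<Longrightarrow>
        a h \<bullet> q = m h + l h * (a h \<bullet> v - c h)"
    "\<And>h q. h \<in> F \<Longrightarrow> q \<in> Q \<Longrightarrow> m h \<le> a h \<bullet> q \<and> a h \<bullet> q \<le> m h + l h * (b h - c h)"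
proof -
  have comp: "compact Q" using Q polytope_imp_compact by blast
  have "\<exists>q\<in>Q. \<forall>x\<in>Q. a h \<bullet> x \<le> a h \<bullet> q" for h
    by (rule continuous_attains_sup[OF comp Q(2)]) (intro continuous_intros)
  then obtain top where top: "\<And>h. top h \<in> Q" "\<And>h x. x \<in> Q \<Longrightarrow> a h \<bullet> x \<le> a h \<bullet> top h" by metis
  have "\<exists>q\<in>Q. \<forall>x\<in>Q. a h \<bullet> q \<le> a h \<bullet> x" for h
    by (rule continuous_attains_inf[OF comp Q(2)]) (intro continuous_intros)
  then obtain bot where bot: "\<And>h. bot h \<in> Q" "\<And>h x. x \<in> Q \<Longrightarrow> a h \<bullet> bot h \<le> a h \<bullet> x" by metis
  define m where "m h = a h \<bullet> bot h" for h
  define l where "l h = (a h \<bullet> top h - m h) / (b h - c h)" for h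
  have l: "m h + l h * (b h - c h) = a h \<bullet> top h" if "h \<in> F" for h
    using gap[OF that] by (simp add: l_def)
  show ?thesis
  proof
    fix h v q r assume h: "h \<in> F" and v: "v extreme_point_of P" "q \<in> Q" "r \<in> R" "v = q + r"
    have "top h + r \<in> P" "bot h + r \<in> P" using sum v top(1) bot(1) by auto
    then have "a h \<bullet> top h + a h \<bullet> r \<le> b h" "c h \<le> a h \<bullet> bot h + a h \<bullet> r"
      using upper[OF h] lower[OF h] by (auto simp flip: inner_add_right)
    moreover have "a h \<bullet> v = a h \<bullet> q + a h \<bullet> r" using v by (simp add: inner_add_right)
    ultimately have "a h \<bullet> v = b h \<Longrightarrow> a h \<bullet> q = a h \<bullet> top h" "a h \<bullet> v = c h \<Longrightarrow> a h \<bullet> q = m h"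
      using top(2)[OF v(2), of h] bot(2)[OF v(2), of h] by (auto simp: m_def)
    then show "a h \<bullet> q = m h + l h * (a h \<bullet> v - c h)"
      using levels[OF h v(1)] l[OF h] by auto
  next
    fix h q assume "h \<in> F" "q \<in> Q"
    then show "m h \<le> a h \<bullet> q \<and> a h \<bullet> q \<le> m h + l h * (b h - c h)"
      using l top(2) bot(2) by (simp add: m_def)
  qed
qed

text \<open>By the previous lemma, sending each vertex of \<open>P\<close> to its \<open>Q\<close>-component extends to the directions as
scaling by the width ratios \<open>l\<close>. If all the ratios were equal to some \<open>L\<close>, then \<open>Q\<close> would be a point
(for \<open>L = 0\<close>, making \<open>R\<close> a translate of \<open>P\<close>) or a homothetic copy of \<open>P\<close> with factor \<open>L > 0\<close>.\<close>

lemma summand_multiplier: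
  assumes Q: "polytope Q" "Q \<noteq> {}" and sum: "P = Q + R"
    and Qhom: "\<not> homothetic P Q" and Rhom: "\<not> homothetic P R"
  obtains l where "multiplier l" "\<exists>h\<in>F. \<exists>h'\<in>F. l h \<noteq> l h'"
proof -
  obtain l m where
    slack: "\<And>h v q r. h \<in> F \<Longrightarrow> v extreme_point_of P \<Longrightarrow> q \<in> Q \<Longrightarrow> r \<in> R \<Longrightarrow> v = q + r \<Longrightarrow>
        a h \<bullet> q = m h + l h * (a h \<bullet> v - c h)" and
    range: "\<And>h q. h \<in> F \<Longrightarrow> q \<in> Q \<Longrightarrow> m h \<le> a h \<bullet> q \<and> a h \<bullet> q \<le> m h + l h * (b h - c h)"
    using summand_slacks[OF Q sum] by metis
  have "\<forall>v. \<exists>q r. v extreme_point_of P \<longrightarrow> q \<in> Q \<and> r \<in> R \<and> v = q + r"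
    using sum by (metis extreme_point_of_def set_plus_elim)
  then obtain q r where qr: "\<And>v. v extreme_point_of P \<Longrightarrow> q v \<in> Q \<and> r v \<in> R \<and> v = q v + r v"
    by metis
  have q_diff: "a h \<bullet> (q v - q p) = l h * (a h \<bullet> (v - p))" if "h \<in> F" "v extreme_point_of P" for h v
    using slack[OF that, of "q v" "r v"] qr[OF that(2)]
      slack[OF that(1) vertex, of "q p" "r p"] qr[OF vertex]
    by (simp only: inner_diff_right right_diff_distrib)
  have dir: "y - z \<in> directions" if "y \<in> Q" "z \<in> Q" for y z
  proof -
    have "y + r p \<in> P" "z + r p \<in> P" using that sum qr[OF vertex] by auto
    then have "(y + r p) - (z + r p) \<in> directions" using in_hull diff_in_directions by blast
    then show ?thesis by simp
  qed
  have "multiplier l"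
    unfolding multiplier_def
  proof
    fix d assume "d \<in> directions"
    then have "d \<in> span ((\<lambda>v. v - p) ` vertices)" by (simp add: directions_def)
    then show "\<exists>e\<in>directions. \<forall>h\<in>F. a h \<bullet> e = l h * (a h \<bullet> d)"
    proof (induction rule: span_induct_alt)
      case base
      show ?case by (intro bexI[of _ 0]) (auto simp: subspace_0[OF subspace_directions])
    next
      case (step s x y)
      then obtain v e where v: "v extreme_point_of P" "x = v - p"
        and e: "e \<in> directions" "\<And>h. h \<in> F \<Longrightarrow> a h \<bullet> e = l h * (a h \<bullet> y)" by auto
      have "s *\<^sub>R (q v - q p) + e \<in> directions"
        using dir qr[OF v(1)] qr[OF vertex] e subspace_directions by (simp add: subspace_add subspace_scale)
      moreover have "a h \<bullet> (s *\<^sub>R (q v - q p) + e) = l h * (a h \<bullet> (s *\<^sub>R x + y))" if "h \<in> F" for h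
        using q_diff[OF that v(1)] e(2)[OF that] v(2)
        by (simp add: inner_add_right distrib_left)
      ultimately show ?case by blast
    qed
  qed
  moreover have "\<exists>h\<in>F. \<exists>h'\<in>F. l h \<noteq> l h'"
  proof (rule ccontr)
    assume const: "\<not> (\<exists>h\<in>F. \<exists>h'\<in>F. l h \<noteq> l h')"
    show False
    proof (cases "\<forall>h\<in>F. l h = 0")
      case True
      have "Q = {q p}"
      proof (intro subset_antisym subsetI)
        fix y assume "y \<in> Q"
        then have "y - q p = 0"
          using range[OF _ \<open>y \<in> Q\<close>] range[of _ "q p"] qr[OF vertex] True
          by (intro separation dir) (force simp: inner_diff_right)+
        then show "y \<in> {q p}" by simp
      qed (use qr[OF vertex] in simp)
      then have "P = (\<lambda>x. q p + x) ` R" using sum by (auto simp: set_plus_def)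
      then have "R = (\<lambda>x. 1 *\<^sub>R x + (- q p)) ` P" by (simp add: image_image)
      then show False using Rhom unfolding homothetic_def by (metis zero_less_one)
    next
      case False
      then obtain h0 where h0: "h0 \<in> F" "l h0 \<noteq> 0" by blast
      define L where "L = l h0"
      have lL: "l h = L" if "h \<in> F" for h using const that h0 unfolding L_def by blast
      have "0 \<le> l h0 * (b h0 - c h0)" using range[OF h0(1), of "q p"] qr[OF vertex] by linarith
      then have "L > 0" using h0 gap[OF h0(1)] unfolding L_def
        by (metis diff_gt_0_iff_gt less_eq_real_def zero_le_mult_iff not_le)
      define t where "t = q p - L *\<^sub>R p"
      \<comment> \<open>The vertices of \<open>P\<close> have their scaled copies in \<open>Q\<close>; the facet inequalities then give the reverse inclusion.\<close>
      have "q v = L *\<^sub>R v + t" if "v extreme_point_of P" for v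
      proof -
        have "(q v - q p) - L *\<^sub>R (v - p) = 0"
        proof (rule separation)
          show "(q v - q p) - L *\<^sub>R (v - p) \<in> directions"
          proof (rule subspace_diff[OF subspace_directions])
            show "q v - q p \<in> directions" using dir qr[OF that] qr[OF vertex] by blast
            have "v \<in> P" using that by (simp add: extreme_point_of_def)
            then show "L *\<^sub>R (v - p) \<in> directions"
              by (intro subspace_scale[OF subspace_directions] diff_in_directions in_hull p_in)
          qed
        qed (simp add: inner_diff_right[of _ "q v - q p"] q_diff that lL)
        then show ?thesis by (simp add: t_def algebra_simps)
      qed
      then have "(\<lambda>x. t + L *\<^sub>R x) ` vertices \<subseteq> Q" using qr by (metis (no_types, lifting) add.commute image_subsetI mem_Collect_eq)
      then have "convex hull ((\<lambda>x. t + L *\<^sub>R x) ` vertices) \<subseteq> Q"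
        by (rule hull_minimal) (use Q polytope_imp_convex in blast)
      then have "(\<lambda>x. t + L *\<^sub>R x) ` P \<subseteq> Q"
        unfolding convex_hull_affinity using hull_vertices by simp
      moreover have "Q \<subseteq> (\<lambda>x. t + L *\<^sub>R x) ` P"
      proof
        fix y assume y: "y \<in> Q"
        define x where "x = p + (1 / L) *\<^sub>R (y - q p)"
        have "x \<in> P"
        proof (rule sufficient)
          show "x \<in> affine hull P"
            unfolding x_def using y qr[OF vertex] subspace_directions
            by (intro add_direction in_hull p_in subspace_scale dir) auto
          fix h assume h: "h \<in> F"
          have "L * (a h \<bullet> x) = L * (a h \<bullet> p) + (a h \<bullet> y - a h \<bullet> q p)"
            using \<open>L > 0\<close> by (simp add: x_def inner_add_right inner_diff_right field_simps)
          also have "\<dots> \<le> L * b h"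
            using range[OF h y] slack[OF h vertex, of "q p" "r p"] qr[OF vertex] lL[OF h]
            by (simp add: algebra_simps)
          finally show "a h \<bullet> x \<le> b h" using \<open>L > 0\<close> by simp
        qed
        moreover have "y = t + L *\<^sub>R x" using \<open>L > 0\<close> by (simp add: x_def t_def algebra_simps)
        ultimately show "y \<in> (\<lambda>x. t + L *\<^sub>R x) ` P" by blast
      qed
      ultimately have "Q = (\<lambda>x. L *\<^sub>R x + t) ` P" by (simp add: add.commute)
      then show False using Qhom \<open>L > 0\<close> unfolding homothetic_def by blast
    qed
  qed
  ultimately show ?thesis using that by blast
qed

text \<open>Grouping the facets by whether their width ratio equals that of a chosen facet \<open>h\<close> gives the splitting.\<close>

lemma decomposable_imp_product:
  assumes "decomposable P" and C: "\<And>K. K face_of P \<Longrightarrow> K \<noteq> {} \<Longrightarrow> C K"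
  shows "product_of_proper C P"
proof -
  obtain Q R where QR: "polytope Q" "Q \<noteq> {}" "P = Q + R" "\<not> homothetic P Q" "\<not> homothetic P R"
    using assms by (auto simp: decomposable_def)
  obtain l where l: "multiplier l" "\<exists>h\<in>F. \<exists>h'\<in>F. l h \<noteq> l h'"
    by (rule summand_multiplier[OF QR])
  obtain h h' where h: "h \<in> F" "h' \<in> F" "l h \<noteq> l h'" using l(2) by blast
  define I where "I = {g \<in> F. l g = l h}"
  have "multiplier (\<lambda>g. if g \<in> I then 1 else 0)"
    using multiplier_indicator[OF l(1), of "l h"] unfolding multiplier_def I_def by simp
  moreover have "h \<in> I" "h' \<notin> I" "I \<subseteq> F" using h by (auto simp: I_def)
  ultimately show ?thesis using split_product[of I C] h(2) C by blast
qed

end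

text \<open>Take an irredundant representation of \<open>P\<close> by halfspaces, whose boundaries all define facets. No facet
contains all vertices, and \<open>c h\<close> is the value at some vertex off the facet of \<open>h\<close>.\<close>

lemma two_level_inequalities_exist:
  fixes P :: "'a::euclidean_space set"
  assumes "two_level P"
  obtains F :: "'a set set" and a b c p where "two_level_inequalities P F a b c p"
proof -
  have P: "polytope P" "P \<noteq> {}" and crit: "at_most_two_levels P {v. v extreme_point_of P}"
    using assms by (auto simp: two_level_iff)
  have hull: "P = convex hull {v. v extreme_point_of P}"
    by (rule Krein_Milman_Minkowski[OF polytope_imp_compact[OF P(1)] polytope_imp_convex[OF P(1)]])
  obtain p where p: "p extreme_point_of P"
    using hull P by (metis (no_types, lifting) Collect_empty_eq convex_hull_empty)
  obtain F where F: "finite F" "P = affine hull P \<inter> \<Inter>F"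
    "\<forall>h\<in>F. \<exists>a b. a \<noteq> 0 \<and> h = {x. a \<bullet> x \<le> b}"
    "\<And>F'. F' \<subset> F \<Longrightarrow> P \<subset> affine hull P \<inter> \<Inter>F'"
    using polytope_imp_polyhedron[OF P(1)] unfolding polyhedron_Int_affine_minimal by meson
  from F(3) obtain a b where ab: "\<And>h. h \<in> F \<Longrightarrow> a h \<noteq> 0 \<and> h = {x. a h \<bullet> x \<le> b h}" by metis
  have facet: "(P \<inter> {x. a h \<bullet> x = b h}) facet_of P" if "h \<in> F" for h
    using facet_of_polyhedron_explicit[OF F(1,2) ab F(4)] that by blast
  have le: "a h \<bullet> x \<le> b h" if "h \<in> F" "x \<in> P" for h x using that F(2) ab by blast
  have "\<exists>v. v extreme_point_of P \<and> a h \<bullet> v \<noteq> b h" if "h \<in> F" for h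
  proof (rule ccontr)
    assume "\<nexists>v. v extreme_point_of P \<and> a h \<bullet> v \<noteq> b h"
    then have "{v. v extreme_point_of P} \<subseteq> {x. a h \<bullet> x = b h}" by blast
    then have "convex hull {v. v extreme_point_of P} \<subseteq> {x. a h \<bullet> x = b h}"
      by (rule hull_minimal) (rule convex_hyperplane)
    then have "P \<inter> {x. a h \<bullet> x = b h} = P" using hull by blast
    then show False using facet[OF that] by simp
  qed
  then obtain v where v: "\<And>h. h \<in> F \<Longrightarrow> v h extreme_point_of P \<and> a h \<bullet> v h \<noteq> b h" by metis
  have vP: "v h \<in> P" if "h \<in> F" for h using v[OF that] by (simp add: extreme_point_of_def)
  have "two_level_inequalities P F a b (\<lambda>h. a h \<bullet> v h) p"
  proof
    fix x assume "x \<in> affine hull P" "\<And>h. h \<in> F \<Longrightarrow> a h \<bullet> x \<le> b h"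
    then show "x \<in> P" using F(2) ab by blast
  next
    fix h assume h: "h \<in> F"
    show "a h \<bullet> v h < b h" using le[OF h vP[OF h]] v[OF h] by simp
    obtain y where "y \<in> P" "a h \<bullet> y = b h" using facet[OF h] by (auto simp: facet_of_def)
    then show "\<exists>x\<in>P. \<exists>y\<in>P. a h \<bullet> x \<noteq> a h \<bullet> y" using vP[OF h] v[OF h] by metis
  next
    fix h w assume h: "h \<in> F" and w: "w extreme_point_of P"
    have "P \<subseteq> {x. a h \<bullet> x \<le> b h}" using le[OF h] by blast
    then show "a h \<bullet> w = b h \<or> a h \<bullet> w = a h \<bullet> v h"
      using crit facet[OF h] ab[OF h] w v[OF h] unfolding at_most_two_levels_def by blast
  qed (use P F p le in auto)
  then show ?thesis using that by blast
qed

section \<open>The characterization of decomposability\<close>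

theorem theorem4p3:
  fixes P :: "(real ^ 'n) set"
  shows
    "(two_level P \<longrightarrow>
        (decomposable P \<longleftrightarrow> product_of_proper (two_level :: (real ^ 'n) set \<Rightarrow> bool) P) \<and>
        (product_of_proper (two_level :: (real ^ 'm) set \<Rightarrow> bool) P \<longrightarrow> decomposable P)) \<and>
     (compressed P \<longrightarrow>
        (decomposable P \<longleftrightarrow> product_of_proper (compressed :: (real ^ 'n) set \<Rightarrow> bool) P) \<and>
        (product_of_proper (compressed :: (real ^ 'm) set \<Rightarrow> bool) P \<longrightarrow> decomposable P))"
proof (intro conjI impI)
  assume P: "two_level P"
  then have poly: "polytope P" by (simp add: two_level_iff)
  obtain F :: "(real ^ 'n) set set" and a b c p where "two_level_inequalities P F a b c p"
    using two_level_inequalities_exist[OF P] .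
  then interpret two_level_inequalities P F a b c p .
  show "decomposable P \<longleftrightarrow> product_of_proper (two_level :: (real ^ 'n) set \<Rightarrow> bool) P"
    using product_imp_decomposable[OF poly] decomposable_imp_product two_level_face[OF P] by blast
  show "decomposable P" if "product_of_proper (two_level :: (real ^ 'm) set \<Rightarrow> bool) P"
    using product_imp_decomposable[OF poly that] .
next
  assume P: "compressed P"
  then have two: "two_level P" by (rule compressed_imp_two_level)
  then have poly: "polytope P" by (simp add: two_level_iff)
  obtain F :: "(real ^ 'n) set set" and a b c p where "two_level_inequalities P F a b c p"
    using two_level_inequalities_exist[OF two] .
  then interpret two_level_inequalities P F a b c p .
  show "decomposable P \<longleftrightarrow> product_of_proper (compressed :: (real ^ 'n) set \<Rightarrow> bool) P"
    using product_imp_decomposable[OF poly] decomposable_imp_product compressed_face[OF P] by blast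
  show "decomposable P" if "product_of_proper (compressed :: (real ^ 'm) set \<Rightarrow> bool) P"
    using product_imp_decomposable[OF poly that] .
qed

end
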